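(* Let $\epsilon>0$ and $0<\alpha<1$. Let $$N_\epsilon=\left(\frac4\epsilon\right)^{\frac1{1-\alpha}},\qquad t_0=\frac{\ln(\epsilon/4)}{\ln|1-2\mu|}\ \ (\text{i.e. } |1-2\mu|^{t_0}=\epsilon/4),\qquad t_N=\frac12N^\alpha.$$ Then, for all $N>N_\epsilon$ and for all $t_0\leq t\leq t_N$, one has $$P(\Omega(\epsilon,N,t))\geq1-2\exp\left(2\left(\tfrac\epsilon2\right)^2\right)\exp\left(-2\left(\tfrac\epsilon2\right)^2N^{1-\alpha}\right).$$ Hence $$P(\Omega_{t_N})\geq1-\exp\left(2\left(\tfrac\epsilon2\right)^2\right)N^{\alpha}\exp\left(-2\left(\tfrac\epsilon2\right)^2N^{1-\alpha}\right).$$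
   Context: Kac ring model. There are $N$ equidistant sites on a circle, indexed by integers modulo $N$, with one ball per site, each ball being white or black. To each site $n$ is attached $\xi_n\in\{-1,1\}$, with $\xi_n=-1$ if site $n$ is marked and $\xi_n=1$ otherwise. Let $\eta_n(t)=1$ if at integer time $t$ the ball at site $n$ is white, and $\eta_n(t)=-1$ if it is black. At each integer time all balls move one step counterclockwise, and a ball changes color if it starts on a marked site, and not otherwise: $$\eta_n(t)=\xi_{n-1}\eta_{n-1}(t-1)\quad(\text{indices modulo }N),\qquad \eta_n(0)=1\ \text{for all } n.$$ Let $\Delta(t)$ be the number of white balls minus the number of black balls at time $t$ and $\overline{\Delta(t)}=\Delta(t)/N$; thus $$\Delta(t)=\sum_{n=0}^{N-1}\xi_{n-1}\xi_{n-2}\cdots\xi_{n-t}.$$ The $\xi_n$ (one for each of the $N$ sites) are independent random variables with, for some fixed $0<\mu\leq1$, $P(\xi_n=-1)=\mu$ and $P(\xi_n=1)=1-\mu$; $P$ denotes the corresponding probability on $\{-1,1\}^N$. For $\epsilon>0$ and for each $t$ and $N$, define $$\Omega(\epsilon,N,t)=\{(\xi_1,\dots,\xi_N)\in\{-1,1\}^N : |\overline{\Delta(t)}|\leq\epsilon\},$$ and $$\Omega_T=\bigcap_{t=1}^{T}\Omega(\epsilon,N,t)$$ (the intersection over integer times $t$ from $1$ up to $T$; the dependence on $\epsilon$ and $N$ is suppressed in the notation).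
   Formalization: The final bound fails for Ω_{t_N} from t=1 (early times); it is proved for the intersection over integers t≥1 with t_0≤t≤t_N, and for Ω_{t_N} itself if t_0≤1. Where t_0 is undefined (μ=1/2, μ=1) it is set to its limit, with t>0 required at μ=1/2. *)

theory Defs
  imports "HOL-Probability.Probability"
begin

text \<open>
  The sites of the ring are the residues \<open>0, \<dots>, N - 1\<close>; site \<open>N\<close> of the labelling
  \<open>1, \<dots>, N\<close> is site \<open>0\<close> here. A marking assigns \<open>-1\<close> to the marked sites and \<open>1\<close> to the
  others; markings are extensional, so that they correspond one-to-one to \<open>{-1,1}\<^sup>N\<close>.
\<close>

definition kac_sites :: "nat \<Rightarrow> int set" where
  "kac_sites N = {0..<int N}"

definition kac_markings :: "nat \<Rightarrow> (int \<Rightarrow> int) set" where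
  "kac_markings N = kac_sites N \<rightarrow>\<^sub>E {-1, 1}"

text \<open>\<open>kac_eta N \<xi> t n\<close> is the colour at time \<open>t\<close> at site \<open>n\<close>: \<open>1\<close> is white, \<open>-1\<close> is black.\<close>

primrec kac_eta :: "nat \<Rightarrow> (int \<Rightarrow> int) \<Rightarrow> nat \<Rightarrow> int \<Rightarrow> int" where
  "kac_eta N \<xi> 0 n = 1"
| "kac_eta N \<xi> (Suc t) n =
     \<xi> ((n - 1) mod int N) * kac_eta N \<xi> t ((n - 1) mod int N)"

definition kac_Delta :: "nat \<Rightarrow> (int \<Rightarrow> int) \<Rightarrow> nat \<Rightarrow> int" where
  "kac_Delta N \<xi> t = int (card {n \<in> kac_sites N. kac_eta N \<xi> t n = 1})
                    - int (card {n \<in> kac_sites N. kac_eta N \<xi> t n = -1})"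

definition kac_mean :: "nat \<Rightarrow> (int \<Rightarrow> int) \<Rightarrow> nat \<Rightarrow> real" where
  "kac_mean N \<xi> t = real_of_int (kac_Delta N \<xi> t) / real N"

definition kac_prob :: "nat \<Rightarrow> real \<Rightarrow> (int \<Rightarrow> int) pmf" where
  "kac_prob N \<mu> = Pi_pmf (kac_sites N) undefined
     (\<lambda>_. map_pmf (\<lambda>marked. if marked then -1 else 1) (bernoulli_pmf \<mu>))"

definition kac_Omega :: "real \<Rightarrow> nat \<Rightarrow> nat \<Rightarrow> (int \<Rightarrow> int) set" where
  "kac_Omega \<epsilon> N t = {\<xi> \<in> kac_markings N. \<bar>kac_mean N \<xi> t\<bar> \<le> \<epsilon>}"

text \<open>
  The bounds on the times are not integers in general. The intersection with the space of all
  markings only matters if no integer time lies between the bounds.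
\<close>

definition kac_Omega_between :: "real \<Rightarrow> nat \<Rightarrow> ereal \<Rightarrow> real \<Rightarrow> (int \<Rightarrow> int) set" where
  "kac_Omega_between \<epsilon> N S T =
     kac_markings N \<inter>
     (\<Inter>t\<in>{t. 1 \<le> t \<and> S \<le> ereal (real t) \<and> real t \<le> T}. kac_Omega \<epsilon> N t)"

definition kac_Omega_upto :: "real \<Rightarrow> nat \<Rightarrow> real \<Rightarrow> (int \<Rightarrow> int) set" where
  "kac_Omega_upto \<epsilon> N T =
     kac_markings N \<inter> (\<Inter>t\<in>{t. 1 \<le> t \<and> real t \<le> T}. kac_Omega \<epsilon> N t)"

definition kac_N_eps :: "real \<Rightarrow> real \<Rightarrow> real" where
  "kac_N_eps \<epsilon> \<alpha> = (4 / \<epsilon>) powr (1 / (1 - \<alpha>))"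

text \<open>
  The solution \<open>t\<^sub>0\<close> of \<open>\<bar>1 - 2 * \<mu>\<bar> powr t\<^sub>0 = \<epsilon> / 4\<close>. The quotient of logarithms makes no sense
  if \<open>\<mu> = 1 / 2\<close> (logarithm of \<open>0\<close>) or \<open>\<mu> = 1\<close> (division by \<open>0\<close>); there \<open>t\<^sub>0\<close> is the limit of
  the quotient.
\<close>

definition kac_t0 :: "real \<Rightarrow> real \<Rightarrow> ereal" where
  "kac_t0 \<epsilon> \<mu> =
     (if \<mu> = 1 / 2 then 0
      else if \<mu> = 1 then (if \<epsilon> < 4 then \<infinity> else if \<epsilon> = 4 then 0 else -\<infinity>)
      else ereal (ln (\<epsilon> / 4) / ln \<bar>1 - 2 * \<mu>\<bar>))"

definition kac_tN :: "real \<Rightarrow> nat \<Rightarrow> real" where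
  "kac_tN \<alpha> N = 1 / 2 * real N powr \<alpha>"

lemma kac_t0_powr:
  assumes "0 < \<epsilon>" "0 < \<mu>" "\<mu> < 1" "\<mu> \<noteq> 1 / 2"
  shows "\<exists>s. kac_t0 \<epsilon> \<mu> = ereal s \<and> \<bar>1 - 2 * \<mu>\<bar> powr s = \<epsilon> / 4"
proof -
  have "ln \<bar>1 - 2 * \<mu>\<bar> < 0" using assms by (auto simp: abs_if)
  then show ?thesis using assms by (auto simp: kac_t0_def powr_def)
qed

lemma kac_eta_eq_prod:
  assumes "0 < N"
  shows "kac_eta N \<xi> t n = (\<Prod>j=1..t. \<xi> ((n - int j) mod int N))"
proof (induction t arbitrary: n)
  case (Suc t)
  have "(\<Prod>j=1..Suc t. \<xi> ((n - int j) mod int N))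
      = \<xi> ((n - 1) mod int N) * (\<Prod>j=1..t. \<xi> ((n - int (Suc j)) mod int N))"
    using prod.atLeast_Suc_atMost[of 1 "Suc t" "\<lambda>j. \<xi> ((n - int j) mod int N)"]
      prod.shift_bounds_cl_Suc_ivl[of "\<lambda>j. \<xi> ((n - int j) mod int N)" 1 t]
    by simp
  moreover have "((n - 1) mod int N - int j) mod int N = (n - int (Suc j)) mod int N" for j
    by (simp add: mod_diff_left_eq algebra_simps)
  ultimately show ?case using Suc.IH by simp
qed simp

lemma kac_Delta_eq_sum:
  assumes "0 < N" "\<xi> \<in> kac_markings N"
  shows "kac_Delta N \<xi> t = (\<Sum>n\<in>kac_sites N. \<Prod>j=1..t. \<xi> ((n - int j) mod int N))"
proof -
  have mark: "\<xi> (k mod int N) = 1 \<or> \<xi> (k mod int N) = -1" for k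
    using assms by (auto simp: kac_markings_def kac_sites_def PiE_iff)
  have val: "kac_eta N \<xi> t n = 1 \<or> kac_eta N \<xi> t n = -1" for n
  proof (induction t arbitrary: n)
    case (Suc t)
    show ?case using mark[of "n - 1"] Suc.IH[of "(n - 1) mod int N"] by auto
  qed simp
  have fin: "finite (kac_sites N)" by (simp add: kac_sites_def)
  have "(\<Sum>n\<in>kac_sites N. kac_eta N \<xi> t n)
      = (\<Sum>n\<in>kac_sites N. of_bool (kac_eta N \<xi> t n = 1) - of_bool (kac_eta N \<xi> t n = -1))"
  proof (rule sum.cong)
    show "kac_eta N \<xi> t n = of_bool (kac_eta N \<xi> t n = 1) - of_bool (kac_eta N \<xi> t n = -1)" for n
      using val[of n] by auto
  qed simp
  also have "\<dots> = kac_Delta N \<xi> t"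
    using fin by (simp add: kac_Delta_def sum_subtractf Int_def)
  finally show ?thesis using kac_eta_eq_prod[OF assms(1)] by simp
qed

end

theory Submission imports Defs begin

text \<open>
  Let \<open>X n\<close> be the product of the \<open>t\<close> successive marks from site \<open>n\<close> on. The mean of the \<open>X n\<close> over
  the ring is exactly the average, over all starting sites \<open>r\<close>, of the means of
  \<open>X r, X (r + t), \<dots>, X (r + (k - 1) * t)\<close> with \<open>k = N div t\<close>, and the variables in each of these
  progressions are independent with expectation \<open>(1 - 2 * \<mu>) ^ t\<close>. By convexity of \<open>exp\<close>,
  Hoeffding's bound for \<open>k\<close> independent variables survives the averaging over \<open>r\<close>. The expectation
  is at most \<open>\<epsilon> / 4\<close> in absolute value once \<open>t\<^sub>0 \<le> t\<close>, so only deviations by at least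
  \<open>3 / 4 * \<epsilon>\<close> matter; since \<open>k \<ge> 2 * N powr (1 - \<alpha>) - 1\<close>, Hoeffding's exponent beats the
  required one. A union bound over the times up to \<open>t\<^sub>N\<close> gives the rest. For \<open>\<epsilon> \<ge> 1\<close> the
  events are the whole space.
\<close>

section \<open>Hoeffding bounds for averages over internally independent families\<close>

lemma exp_mean_le:
  fixes z :: "'r \<Rightarrow> real"
  assumes "finite R" "R \<noteq> {}"
  shows "exp ((\<Sum>r\<in>R. z r) / card R) \<le> (\<Sum>r\<in>R. exp (z r)) / card R"
  using convex_on_sum[OF assms exp_convex, of "\<lambda>_. 1 / card R" z] assms
  by (simp add: sum_divide_distrib)

context prob_space
begin

text \<open>Jensen's inequality for \<open>exp\<close> pulls the average over \<open>R\<close> out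
  of the exponential, and integration is linear, so independence enters only inside a fixed
  \<open>X r\<close>; dependence between different \<open>r\<close> is harmless. The Chernoff bound
  is then that of a single family of \<open>card J\<close> variables.\<close>

lemma Hoeffding_mean_ge:
  fixes X :: "'r \<Rightarrow> 'j \<Rightarrow> 'a \<Rightarrow> real" and a b p \<delta> :: real
  assumes R: "finite R" "R \<noteq> {}" and J: "finite J" "J \<noteq> {}"
    and indep: "\<And>r. r \<in> R \<Longrightarrow> indep_vars (\<lambda>_. borel) (X r) J"
    and bounded: "\<And>r j. r \<in> R \<Longrightarrow> j \<in> J \<Longrightarrow> AE x in M. X r j x \<in> {a..b}"
    and mean: "\<And>r j. r \<in> R \<Longrightarrow> j \<in> J \<Longrightarrow> expectation (X r j) = p"
    and "a < b" "0 < \<delta>"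
  shows "prob {x \<in> space M. p + \<delta> \<le> (\<Sum>r\<in>R. (\<Sum>j\<in>J. X r j x) / card J) / card R}
           \<le> exp (- 2 * real (card J) * \<delta>\<^sup>2 / (b - a)\<^sup>2)"
proof -
  define k where "k = real (card J)"
  define n where "n = real (card R)"
  define d where "d = (b - a)\<^sup>2"
  \<comment> \<open>minimizes the exponent \<open>l\<^sup>2 * d / (8 * k) - l * \<delta>\<close> of the Chernoff bound\<close>
  define l where "l = 4 * \<delta> * k / d"
  define A where "A = (\<lambda>x. (\<Sum>r\<in>R. (\<Sum>j\<in>J. X r j x) / k) / n)"
  have k: "k > 0" and n: "n > 0" using R J by (auto simp: k_def n_def card_gt_0_iff)
  have d: "d > 0" using \<open>a < b\<close> by (simp add: d_def)
  have l: "l > 0" using k d \<open>0 < \<delta>\<close> by (simp add: l_def)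
  have rv [measurable]: "X r j \<in> borel_measurable M" if "r \<in> R" "j \<in> J" for r j
    using indep[OF that(1)] that(2) unfolding indep_vars_def by blast
  have A_meas [measurable]: "A \<in> borel_measurable M"
    unfolding A_def by measurable
  have pointwise: "exp (l * (A x - p)) \<le> (\<Sum>r\<in>R. (\<Prod>j\<in>J. exp (l / k * (X r j x - p))) / n)" for x
  proof -
    have "l * (A x - p) = (\<Sum>r\<in>R. \<Sum>j\<in>J. l / k * (X r j x - p)) / card R"
    proof -
      have "(\<Sum>r\<in>R. \<Sum>j\<in>J. l / k * (X r j x - p)) = l / k * (\<Sum>r\<in>R. (\<Sum>j\<in>J. X r j x) - k * p)"
        by (simp add: sum_distrib_left sum_subtractf k_def algebra_simps)
      also have "\<dots> = l * ((\<Sum>r\<in>R. (\<Sum>j\<in>J. X r j x) / k) - n * p)"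
        using k by (simp add: sum_subtractf n_def field_simps flip: sum_divide_distrib)
      finally show ?thesis using n by (simp add: A_def n_def field_simps)
    qed
    then have "exp (l * (A x - p)) \<le> (\<Sum>r\<in>R. exp (\<Sum>j\<in>J. l / k * (X r j x - p))) / card R"
      using exp_mean_le[OF R] by simp
    then show ?thesis by (simp add: exp_sum J sum_divide_distrib n_def)
  qed
  \<comment> \<open>Independence turns the integral of the product into a product of integrals.
    Hoeffding's lemma bounds each by \<open>exp ((l / k)\<^sup>2 * d / 8)\<close>, and there are
    \<open>k\<close> of them.\<close>
  have mgf: "(\<integral>\<^sup>+x. ennreal ((\<Prod>j\<in>J. exp (l / k * (X r j x - p))) / n) \<partial>M)
      \<le> ennreal (exp (l\<^sup>2 * d / (8 * k)) / n)" if r: "r \<in> R" for r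
  proof -
    have "(\<integral>\<^sup>+x. ennreal (\<Prod>j\<in>J. exp (l / k * (X r j x - p))) \<partial>M)
        = (\<integral>\<^sup>+x. (\<Prod>j\<in>J. ennreal (exp (l / k * (X r j x - p)))) \<partial>M)"
      by (simp add: prod_ennreal)
    also have "\<dots> = (\<Prod>j\<in>J. \<integral>\<^sup>+x. ennreal (exp (l / k * (X r j x - p))) \<partial>M)"
      by (intro indep_vars_nn_integral J indep_vars_compose2[OF indep[OF r]]) auto
    also have "\<dots> \<le> (\<Prod>j\<in>J. ennreal (exp ((l / k)\<^sup>2 * d / 8)))"
    proof (intro prod_mono_ennreal)
      fix j assume j: "j \<in> J"
      interpret interval_bounded_random_variable M "X r j" a b
        by unfold_locales (use bounded r j rv in auto)
      show "(\<integral>\<^sup>+x. ennreal (exp (l / k * (X r j x - p))) \<partial>M) \<le> ennreal (exp ((l / k)\<^sup>2 * d / 8))"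
        using Hoeffdings_lemma_nn_integral[of "l / k"] l k mean[OF r j] by (simp add: d_def)
    qed
    also have "\<dots> = ennreal (exp (k * ((l / k)\<^sup>2 * d / 8)))"
      by (simp add: ennreal_power k_def flip: exp_of_nat_mult)
    also have "k * ((l / k)\<^sup>2 * d / 8) = l\<^sup>2 * d / (8 * k)"
      using k by (simp add: field_simps power2_eq_square)
    finally show ?thesis
      using n r by (simp add: nn_integral_divide divide_right_mono_ennreal prod_nonneg
          flip: divide_ennreal)
  qed
  have "ennreal (prob {x \<in> space M. p + \<delta> \<le> A x}) = emeasure M {x \<in> space M. A x - p \<ge> \<delta>}"
    by (simp add: emeasure_eq_measure algebra_simps)
  also have "\<dots> \<le> ennreal (exp (- l * \<delta>)) * (\<integral>\<^sup>+x\<in>space M. exp (l * (A x - p)) \<partial>M)"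
    by (intro Chernoff_ineq_nn_integral_ge l) auto
  also have "(\<integral>\<^sup>+x\<in>space M. exp (l * (A x - p)) \<partial>M) = (\<integral>\<^sup>+x. ennreal (exp (l * (A x - p))) \<partial>M)"
    by (intro nn_integral_cong) simp
  also have "\<dots> \<le> (\<integral>\<^sup>+x. (\<Sum>r\<in>R. ennreal ((\<Prod>j\<in>J. exp (l / k * (X r j x - p))) / n)) \<partial>M)"
    using pointwise n by (intro nn_integral_mono) (simp add: sum_ennreal prod_nonneg ennreal_leI)
  also have "\<dots> = (\<Sum>r\<in>R. \<integral>\<^sup>+x. ennreal ((\<Prod>j\<in>J. exp (l / k * (X r j x - p))) / n) \<partial>M)"
    by (intro nn_integral_sum) measurable
  also have "\<dots> \<le> (\<Sum>r\<in>R. ennreal (exp (l\<^sup>2 * d / (8 * k)) / n))"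
    by (intro sum_mono mgf)
  also have "\<dots> = ennreal (exp (l\<^sup>2 * d / (8 * k)))"
    using n by (simp add: n_def ennreal_of_nat_eq_real_of_nat flip: ennreal_mult)
  also have "ennreal (exp (- l * \<delta>)) * \<dots> = ennreal (exp (l\<^sup>2 * d / (8 * k) - l * \<delta>))"
    by (simp flip: ennreal_mult exp_add)
  also have "l\<^sup>2 * d / (8 * k) - l * \<delta> = - 2 * k * \<delta>\<^sup>2 / d"
    using d k by (simp add: l_def field_simps power2_eq_square)
  finally show ?thesis
    by (simp add: A_def n_def d_def k_def mult_left_mono)
qed

text \<open>The lower tail is the upper tail of the negated variables, which lie in
  \<open>{- b..- a}\<close> and have mean \<open>- p\<close>. This interval has the same width, so
  both tails obey the same bound.\<close>

lemma Hoeffding_mean_abs_ge: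
  fixes X :: "'r \<Rightarrow> 'j \<Rightarrow> 'a \<Rightarrow> real" and a b p \<delta> :: real
  assumes R: "finite R" "R \<noteq> {}" and J: "finite J" "J \<noteq> {}"
    and indep: "\<And>r. r \<in> R \<Longrightarrow> indep_vars (\<lambda>_. borel) (X r) J"
    and bounded: "\<And>r j. r \<in> R \<Longrightarrow> j \<in> J \<Longrightarrow> AE x in M. X r j x \<in> {a..b}"
    and mean: "\<And>r j. r \<in> R \<Longrightarrow> j \<in> J \<Longrightarrow> expectation (X r j) = p"
    and "a < b" "0 < \<delta>"
  shows "prob {x \<in> space M. \<delta> \<le> \<bar>(\<Sum>r\<in>R. (\<Sum>j\<in>J. X r j x) / card J) / card R - p\<bar>}
           \<le> 2 * exp (- 2 * real (card J) * \<delta>\<^sup>2 / (b - a)\<^sup>2)"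
proof -
  define A where "A = (\<lambda>x. (\<Sum>r\<in>R. (\<Sum>j\<in>J. X r j x) / card J) / card R)"
  have rv [measurable]: "X r j \<in> borel_measurable M" if "r \<in> R" "j \<in> J" for r j
    using indep[OF that(1)] that(2) unfolding indep_vars_def by blast
  have A_meas [measurable]: "A \<in> borel_measurable M"
    unfolding A_def by measurable
  have "prob {x \<in> space M. \<delta> \<le> \<bar>A x - p\<bar>}
      \<le> prob ({x \<in> space M. p + \<delta> \<le> A x} \<union> {x \<in> space M. - p + \<delta> \<le> - A x})"
    by (intro finite_measure_mono) auto
  also have "\<dots> \<le> prob {x \<in> space M. p + \<delta> \<le> A x} + prob {x \<in> space M. - p + \<delta> \<le> - A x}"
    by (intro measure_Un_le) auto
  also have "prob {x \<in> space M. p + \<delta> \<le> A x} \<le> exp (- 2 * real (card J) * \<delta>\<^sup>2 / (b - a)\<^sup>2)"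
    unfolding A_def by (rule Hoeffding_mean_ge[OF assms])
  also have "prob {x \<in> space M. - p + \<delta> \<le> - A x} \<le> exp (- 2 * real (card J) * \<delta>\<^sup>2 / (- a - - b)\<^sup>2)"
  proof -
    have "AE x in M. - X r j x \<in> {- b..- a}" if "r \<in> R" "j \<in> J" for r j
      using bounded[OF that] by eventually_elim auto
    then have "prob {x \<in> space M. - p + \<delta> \<le> (\<Sum>r\<in>R. (\<Sum>j\<in>J. - X r j x) / card J) / card R}
        \<le> exp (- 2 * real (card J) * \<delta>\<^sup>2 / (- a - - b)\<^sup>2)"
      using assms by (intro Hoeffding_mean_ge R J indep_vars_compose2[OF indep]) auto
    then show ?thesis by (simp add: A_def sum_negf)
  qed
  finally show ?thesis by (simp add: A_def algebra_simps)
qed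

text \<open>Each product is a measurable function of the restriction of the family to its block, and
  restrictions to disjoint blocks are independent.\<close>

lemma indep_vars_prod_blocks:
  fixes Z :: "'i \<Rightarrow> 'a \<Rightarrow> real"
  assumes indep: "indep_vars (\<lambda>_. borel) Z I"
    and K: "\<And>j. j \<in> L \<Longrightarrow> K j \<subseteq> I" "disjoint_family_on K L"
  shows "indep_vars (\<lambda>_. borel) (\<lambda>j x. \<Prod>i\<in>K j. Z i x) L"
proof -
  have "indep_vars (\<lambda>_. borel) (\<lambda>j x. \<Prod>i\<in>K j. restrict (\<lambda>i. Z i x) (K j) i) L"
    by (rule indep_vars_compose2[OF indep_vars_restrict[OF indep K],
          where Y = "\<lambda>j f. \<Prod>i\<in>K j. f i"])
       (auto intro!: borel_measurable_prod measurable_component_singleton)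
  then show ?thesis by simp
qed

end

section \<open>Sites, markings and windows of the ring\<close>

lemma finite_kac_sites [simp]: "finite (kac_sites N)"
  and card_kac_sites [simp]: "card (kac_sites N) = N"
  by (simp_all add: kac_sites_def)

lemma mod_in_kac_sites: "0 < N \<Longrightarrow> n mod int N \<in> kac_sites N"
  by (simp add: kac_sites_def)

lemma sum_kac_sites_shift:
  assumes "0 < N"
  shows "(\<Sum>r\<in>kac_sites N. g ((r + c) mod int N)) = sum g (kac_sites N)"
  by (rule sum.reindex_bij_witness[where j = "\<lambda>r. (r + c) mod int N" and i = "\<lambda>n. (n - c) mod int N"])
     (use assms in \<open>auto simp: kac_sites_def mod_simps\<close>)

lemma set_pmf_kac_prob: "set_pmf (kac_prob N \<mu>) \<subseteq> kac_markings N"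
  by (auto simp: kac_prob_def kac_markings_def set_Pi_pmf PiE_dflt_def PiE_def extensional_def)

lemma AE_kac_markings: "AE \<xi> in kac_prob N \<mu>. \<xi> \<in> kac_markings N"
  using set_pmf_kac_prob by (auto simp: AE_measure_pmf_iff)

text \<open>The colour on arrival at \<open>r + (j + 1) * t\<close> of the ball that starts at
  \<open>r + j * t\<close> (modulo \<open>N\<close>). With step numbers \<open>u\<close> in place of
  sites, the windows of one \<open>r\<close> are consecutive intervals.\<close>

definition kac_window :: "nat \<Rightarrow> nat \<Rightarrow> int \<Rightarrow> nat \<Rightarrow> (int \<Rightarrow> int) \<Rightarrow> real" where
  "kac_window N t r j \<xi> = (\<Prod>u\<in>{j * t..<j * t + t}. real_of_int (\<xi> ((r + int u) mod int N)))"

text \<open>Counting backwards from the arrival site, with \<open>i = j * t + t - u\<close>, gives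
  the summands of \<open>kac_Delta_eq_sum\<close>.\<close>

lemma kac_window_eq:
  "kac_window N t r j \<xi> =
     real_of_int (\<Prod>i=1..t. \<xi> (((r + int (j * t + t)) mod int N - int i) mod int N))"
proof -
  have "(\<Prod>u\<in>{j * t..<j * t + t}. \<xi> ((r + int u) mod int N))
      = (\<Prod>i=1..t. \<xi> (((r + int (j * t + t)) mod int N - int i) mod int N))"
    by (rule prod.reindex_bij_witness[where i = "\<lambda>i. j * t + t - i" and j = "\<lambda>u. j * t + t - u"])
       (auto simp: mod_simps of_nat_diff)
  then show ?thesis by (simp only: kac_window_def flip: of_int_prod)
qed

text \<open>For fixed \<open>j\<close> the arrival site is a rotation of \<open>r\<close>, so the
  windows sum over the ring to \<open>kac_Delta\<close> whatever \<open>j\<close> is. Averaging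
  \<open>k\<close> equal sums changes nothing, so the equality is exact even if \<open>t\<close>
  does not divide \<open>N\<close>.\<close>

lemma kac_mean_eq_window:
  assumes "0 < N" "0 < k" "\<xi> \<in> kac_markings N"
  shows "kac_mean N \<xi> t =
    (\<Sum>r\<in>kac_sites N. (\<Sum>j<k. kac_window N t r j \<xi>) / card {..<k}) / card (kac_sites N)"
proof -
  have "(\<Sum>r\<in>kac_sites N. kac_window N t r j \<xi>) = real_of_int (kac_Delta N \<xi> t)" for j
    unfolding kac_window_eq
    by (subst sum_kac_sites_shift[OF assms(1),
          where g = "\<lambda>n. real_of_int (\<Prod>i=1..t. \<xi> ((n - int i) mod int N))"])
       (simp add: kac_Delta_eq_sum assms)
  then have "(\<Sum>r\<in>kac_sites N. \<Sum>j<k. kac_window N t r j \<xi>) = k * real_of_int (kac_Delta N \<xi> t)"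
    by (subst sum.swap) simp
  then show ?thesis
    using assms by (simp add: kac_mean_def flip: sum_divide_distrib)
qed

lemma kac_window_bounded:
  assumes "0 < N" "\<xi> \<in> kac_markings N"
  shows "kac_window N t r j \<xi> \<in> {-1..1}"
proof -
  have "\<bar>\<xi> (n mod int N)\<bar> = 1" for n
  proof -
    have "\<xi> (n mod int N) \<in> {-1, 1}"
      using assms(2) mod_in_kac_sites[OF assms(1)] unfolding kac_markings_def by (rule PiE_mem)
    then show ?thesis by auto
  qed
  then have "\<bar>kac_window N t r j \<xi>\<bar> = 1"
    by (simp add: kac_window_def abs_prod flip: of_int_abs)
  then show ?thesis by auto
qed

section \<open>Independence and expectation of the windows, concentration of the mean\<close>

lemma expectation_kac_mark:
  assumes "n \<in> kac_sites N" "0 \<le> \<mu>" "\<mu> \<le> 1"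
  shows "measure_pmf.expectation (kac_prob N \<mu>) (\<lambda>\<xi>. real_of_int (\<xi> n)) = 1 - 2 * \<mu>"
proof -
  have "measure_pmf.expectation (kac_prob N \<mu>) (\<lambda>\<xi>. real_of_int (\<xi> n))
      = measure_pmf.expectation (map_pmf (\<lambda>\<xi>. \<xi> n) (kac_prob N \<mu>)) real_of_int"
    by simp
  also have "map_pmf (\<lambda>\<xi>. \<xi> n) (kac_prob N \<mu>) =
      map_pmf (\<lambda>marked. if marked then -1 else 1) (bernoulli_pmf \<mu>)"
    unfolding kac_prob_def by (subst Pi_pmf_component) (use assms in auto)
  finally show ?thesis using assms by simp
qed

text \<open>Windows as sets of sites, since the independence of the marks is indexed by sites rather
  than by steps.\<close>

definition kac_block :: "nat \<Rightarrow> nat \<Rightarrow> int \<Rightarrow> nat \<Rightarrow> int set" where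
  "kac_block N t r j = (\<lambda>u. (r + int u) mod int N) ` {j * t..<j * t + t}"

lemma inj_on_kac_step: "inj_on (\<lambda>u. (r + int u) mod int N) {..<N}"
proof (rule inj_onI)
  fix u v assume uv: "u \<in> {..<N}" "v \<in> {..<N}"
    and "(r + int u) mod int N = (r + int v) mod int N"
  then have "int u mod int N = int v mod int N"
    by (metis add_diff_cancel_left' mod_diff_left_eq)
  then show "u = v" using uv by simp
qed

text \<open>\<open>N div t\<close> complete windows take at most \<open>N\<close> steps, one turn of
  the ring; by \<open>inj_on_kac_step\<close> no site is met twice within a turn.\<close>

lemma kac_steps_subset:
  fixes t :: nat assumes "j < N div t" shows "{j * t..<j * t + t} \<subseteq> {..<N}"
proof -
  have "j * t + t = Suc j * t" by simp
  also have "\<dots> \<le> N div t * t" using assms by (intro mult_le_mono1) simp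
  also have "\<dots> \<le> N" by simp
  finally show ?thesis by auto
qed

lemma inj_on_kac_block:
  "j < N div t \<Longrightarrow> inj_on (\<lambda>u. (r + int u) mod int N) {j * t..<j * t + t}"
  by (rule inj_on_subset[OF inj_on_kac_step kac_steps_subset])

lemma kac_block_subset: "0 < N \<Longrightarrow> kac_block N t r j \<subseteq> kac_sites N"
  by (auto simp: kac_block_def mod_in_kac_sites)

lemma card_kac_block: "j < N div t \<Longrightarrow> card (kac_block N t r j) = t"
  by (simp add: kac_block_def card_image inj_on_kac_block)

lemma disjoint_kac_blocks: "disjoint_family_on (kac_block N t r) {..<N div t}"
proof (unfold disjoint_family_on_def, intro ballI impI)
  fix i j assume ij: "i \<in> {..<N div t}" "j \<in> {..<N div t}" "i \<noteq> j"
  \<comment> \<open>A step \<open>u\<close> lies only in the window with number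
    \<open>u div t\<close>, so the step intervals are disjoint; injectivity on one turn carries this
    over to the sites.\<close>
  have "u div t = j" if "u \<in> {j * t..<j * t + t}" for u j :: nat
    using that by (intro div_nat_eqI) (auto simp: mult.commute)
  then have "{i * t..<i * t + t} \<inter> {j * t..<j * t + t} = {}" using ij by blast
  moreover have "kac_block N t r i \<inter> kac_block N t r j =
      (\<lambda>u. (r + int u) mod int N) ` ({i * t..<i * t + t} \<inter> {j * t..<j * t + t})"
    unfolding kac_block_def
    by (intro inj_on_image_Int[OF inj_on_kac_step, symmetric] kac_steps_subset) (use ij in auto)
  ultimately show "kac_block N t r i \<inter> kac_block N t r j = {}" by simp
qed

lemma kac_window_eq_prod_block:
  "j < N div t \<Longrightarrow> kac_window N t r j \<xi> = (\<Prod>n\<in>kac_block N t r j. real_of_int (\<xi> n))"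
  by (simp add: kac_block_def kac_window_def prod.reindex inj_on_kac_block)

lemma indep_vars_kac_marks:
  "prob_space.indep_vars (measure_pmf (kac_prob N \<mu>)) (\<lambda>_. borel)
     (\<lambda>n \<xi>. real_of_int (\<xi> n)) (kac_sites N)"
proof -
  have "prob_space.indep_vars (measure_pmf (kac_prob N \<mu>)) 
      (\<lambda>_. count_space UNIV) (\<lambda>x \<xi>. \<xi> x) (kac_sites N)"
    unfolding kac_prob_def by (rule indep_vars_Pi_pmf) simp
  then show ?thesis
    by (rule prob_space.indep_vars_compose2[OF prob_space_measure_pmf]) auto
qed

lemma indep_vars_kac_window:
  assumes "0 < N"
  shows "prob_space.indep_vars (measure_pmf (kac_prob N \<mu>)) (\<lambda>_. borel)
           (kac_window N t r) {..<N div t}"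
proof -
  have "prob_space.indep_vars (measure_pmf (kac_prob N \<mu>)) (\<lambda>_. borel)
      (\<lambda>j \<xi>. \<Prod>n\<in>kac_block N t r j. real_of_int (\<xi> n)) {..<N div t}"
    by (intro prob_space.indep_vars_prod_blocks[OF prob_space_measure_pmf indep_vars_kac_marks]
        kac_block_subset disjoint_kac_blocks assms)
  then show ?thesis
    by (subst prob_space.indep_vars_cong[OF prob_space_measure_pmf refl _ refl])
       (auto simp: kac_window_eq_prod_block)
qed

text \<open>A window visits \<open>t\<close> distinct sites, so by independence the expectation
  splits into \<open>t\<close> factors \<open>1 - 2 * \<mu>\<close>.\<close>

lemma expectation_kac_window:
  assumes "0 < N" "j < N div t" "0 \<le> \<mu>" "\<mu> \<le> 1"
  shows "measure_pmf.expectation (kac_prob N \<mu>) (kac_window N t r j) = (1 - 2 * \<mu>) ^ t"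
proof -
  let ?E = "measure_pmf.expectation (kac_prob N \<mu>)"
  have fin: "finite (set_pmf (kac_prob N \<mu>))"
    by (rule finite_subset[OF set_pmf_kac_prob]) (simp add: kac_markings_def finite_PiE)
  note sub = kac_block_subset[OF assms(1), of t r j]
  have "?E (kac_window N t r j) =
      ?E (\<lambda>\<xi>. \<Prod>n\<in>kac_block N t r j. real_of_int (\<xi> n))"
    using assms by (intro Bochner_Integration.integral_cong refl kac_window_eq_prod_block)
  also have "\<dots> = (\<Prod>n\<in>kac_block N t r j. ?E (\<lambda>\<xi>. real_of_int (\<xi> n)))"
    by (intro prob_space.indep_vars_lebesgue_integral[OF prob_space_measure_pmf]
        integrable_measure_pmf_finite fin
        prob_space.indep_vars_subset[OF prob_space_measure_pmf indep_vars_kac_marks] sub)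
       (simp add: kac_block_def)
  also have "\<dots> = (\<Prod>n\<in>kac_block N t r j. 1 - 2 * \<mu>)"
    using sub assms by (intro prod.cong expectation_kac_mark) auto
  finally show ?thesis using assms by (simp add: card_kac_block)
qed

lemma kac_mean_concentration:
  assumes "0 < t" "t \<le> N" "0 \<le> \<mu>" "\<mu> \<le> 1" "0 < \<delta>"
  shows "measure_pmf.prob (kac_prob N \<mu>) {\<xi>. \<delta> \<le> \<bar>kac_mean N \<xi> t - (1 - 2 * \<mu>) ^ t\<bar>}
           \<le> 2 * exp (- real (N div t) * \<delta>\<^sup>2 / 2)"
proof -
  let ?P = "measure_pmf.prob (kac_prob N \<mu>)"
  have N: "0 < N" and k: "0 < N div t" using assms by (auto simp: div_greater_zero_iff)
  let ?A = "\<lambda>\<xi>. (\<Sum>r\<in>kac_sites N. (\<Sum>j<N div t. kac_window N t r j \<xi>) / card {..<N div t})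
    / card (kac_sites N)"
  \<comment> \<open>The average of the windows is shown to equal \<open>kac_mean\<close> on
    markings, hence almost surely.\<close>
  have "?P {\<xi>. \<delta> \<le> \<bar>kac_mean N \<xi> t - (1 - 2 * \<mu>) ^ t\<bar>}
      = ?P {\<xi> \<in> space (measure_pmf (kac_prob N \<mu>)). \<delta> \<le> \<bar>?A \<xi> - (1 - 2 * \<mu>) ^ t\<bar>}"
    by (rule measure_eq_AE)
       (use AE_kac_markings in eventually_elim, simp add: kac_mean_eq_window[OF N k], simp_all)
  \<comment> \<open>The windows take values in an interval of width 2, whence the divisor 4 in the
    exponent.\<close>
  also have "\<dots> \<le> 2 * exp (- 2 * real (card {..<N div t}) * \<delta>\<^sup>2 / (1 - (- 1))\<^sup>2)"
  proof (rule prob_space.Hoeffding_mean_abs_ge[OF prob_space_measure_pmf])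
    show "kac_sites N \<noteq> {}" using mod_in_kac_sites[OF N] by auto
    show "AE \<xi> in kac_prob N \<mu>. kac_window N t r j \<xi> \<in> {- 1..1}" for r j
      using AE_kac_markings by eventually_elim (rule kac_window_bounded[OF N])
  qed (use assms N k in \<open>auto intro: indep_vars_kac_window expectation_kac_window\<close>)
  finally show ?thesis by (simp add: algebra_simps)
qed

section \<open>The probability of leaving \<open>kac_Omega\<close> at a single time\<close>

lemma abs_kac_mean_le_1: "\<bar>kac_mean N \<xi> t\<bar> \<le> 1"
proof -
  have card_le: "card {n \<in> kac_sites N. P n} \<le> N" for P
    using card_mono[of "kac_sites N" "{n \<in> kac_sites N. P n}"] by auto
  have "\<bar>kac_Delta N \<xi> t\<bar> \<le> int N"
    unfolding kac_Delta_def
    using card_le[of "\<lambda>n. kac_eta N \<xi> t n = 1"] card_le[of "\<lambda>n. kac_eta N \<xi> t n = -1"]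
    by linarith
  then have "real_of_int \<bar>kac_Delta N \<xi> t\<bar> \<le> real N" by linarith
  then show ?thesis by (auto simp: kac_mean_def divide_le_eq_1)
qed

text \<open>As \<open>\<bar>1 - 2 * \<mu>\<bar> \<le> 1\<close>, powers cannot grow past the
  exponent \<open>kac_t0\<close>, where the value is \<open>\<epsilon> / 4\<close>. The degenerate
  values of \<open>\<mu>\<close> are treated apart.\<close>

lemma kac_t0_le_imp_power_le:
  assumes "0 < \<epsilon>" "\<epsilon> < 4" "0 < \<mu>" "\<mu> \<le> 1" "kac_t0 \<epsilon> \<mu> \<le> ereal (real t)" "\<mu> = 1 / 2 \<longrightarrow> 0 < t"
  shows "0 < t" "\<bar>(1 - 2 * \<mu>) ^ t\<bar> \<le> \<epsilon> / 4"
proof -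
  have "\<bar>1 - 2 * \<mu>\<bar> ^ t \<le> \<epsilon> / 4"
  proof (cases "\<mu> = 1 / 2")
    case True
    \<comment> \<open>The base is \<open>0\<close>, and \<open>0 ^ 0 = 1\<close> exceeds
      \<open>\<epsilon> / 4\<close>; hence \<open>0 < t\<close> is assumed in this case.\<close>
    then have "1 - 2 * \<mu> = 0" by simp
    then show ?thesis using assms by (simp only: abs_zero) (simp add: power_0_left)
  next
    case False
    \<comment> \<open>For \<open>\<mu> = 1\<close> and \<open>\<epsilon> < 4\<close>,
      \<open>kac_t0\<close> is \<open>\<infinity>\<close>, which no \<open>t\<close>
      reaches.\<close>
    then have "\<mu> < 1" using assms by (auto simp: kac_t0_def split: if_splits)
    then obtain s where s: "kac_t0 \<epsilon> \<mu> = ereal s" "\<bar>1 - 2 * \<mu>\<bar> powr s = \<epsilon> / 4"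
      using kac_t0_powr assms False by blast
    have "\<bar>1 - 2 * \<mu>\<bar> powr real t \<le> \<bar>1 - 2 * \<mu>\<bar> powr s"
      using assms s(1) \<open>\<mu> < 1\<close> by (intro powr_mono') auto
    then show ?thesis using s(2) False by (simp add: powr_realpow)
  qed
  then show "\<bar>(1 - 2 * \<mu>) ^ t\<bar> \<le> \<epsilon> / 4" by (simp add: power_abs)
  \<comment> \<open>\<open>t = 0\<close> would give \<open>1 \<le> \<epsilon> / 4\<close>.\<close>
  then show "0 < t" using assms by (cases t) auto
qed

lemma prob_compl_kac_Omega_le:
  assumes "0 < \<epsilon>" "\<alpha> < 1" "0 < \<mu>" "\<mu> \<le> 1" "0 < N"
    and t: "kac_t0 \<epsilon> \<mu> \<le> ereal (real t)" "real t \<le> kac_tN \<alpha> N" "\<mu> = 1 / 2 \<longrightarrow> 0 < t"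
  shows "measure_pmf.prob (kac_prob N \<mu>) (- kac_Omega \<epsilon> N t)
    \<le> 2 * exp (2 * (\<epsilon> / 2)^2) * exp (- 2 * (\<epsilon> / 2)^2 * real N powr (1 - \<alpha>))"
proof (cases "\<epsilon> < 1")
  case False
  then have "kac_Omega \<epsilon> N t = kac_markings N"
    unfolding kac_Omega_def by (auto intro: order_trans[OF abs_kac_mean_le_1])
  \<comment> \<open>The complement is taken among all functions, so it is null rather than
    empty.\<close>
  then have "measure_pmf.prob (kac_prob N \<mu>) (- kac_Omega \<epsilon> N t) = 0"
    using set_pmf_kac_prob by (auto simp: measure_pmf_zero_iff)
  then show ?thesis by simp
next
  case True
  define M where "M = real N powr (1 - \<alpha>)"
  define p where "p = (1 - 2 * \<mu>) ^ t"
  have "0 < t" and p: "\<bar>p\<bar> \<le> \<epsilon> / 4"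
    using kac_t0_le_imp_power_le[of \<epsilon> \<mu> t] assms True by (auto simp: p_def)
  have NM: "real N = real N powr \<alpha> * M"
    using \<open>0 < N\<close> by (simp add: M_def flip: powr_add)
  have M: "1 \<le> M" using assms by (auto simp: M_def intro: ge_one_powr_ge_zero)
  have tM: "2 * M * real t \<le> real N"
  proof -
    have "2 * real t \<le> real N powr \<alpha>" using t(2) by (simp add: kac_tN_def)
    from mult_right_mono[OF this, of M] show ?thesis using M by (subst NM) (simp add: algebra_simps)
  qed
  \<comment> \<open>\<open>t \<le> N\<close> makes room for at least one complete window.\<close>
  have "real t \<le> 2 * M * real t" using M by (intro mult_le_cancel_right1[THEN iffD2]) auto
  with tM have "t \<le> N" by linarith
  \<comment> \<open>Rounding down to complete windows loses less than one window, so
    \<open>N div t\<close> exceeds \<open>2 * M - 1\<close>.\<close>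
  have "real N < real (t + N div t * t)"
    using dividend_less_div_times[OF \<open>0 < t\<close>, of N] by (simp only: of_nat_less_iff)
  with tM have "2 * M * real t < (real (N div t) + 1) * real t" by (simp add: algebra_simps)
  then have k: "2 * M - 1 \<le> real (N div t)" using \<open>0 < t\<close> by simp
  have dev: "3 / 4 * \<epsilon> \<le> \<bar>m - p\<bar>" if "\<epsilon> < \<bar>m\<bar>" for m
    using abs_triangle_ineq2[of m p] p that by linarith
  have "measure_pmf.prob (kac_prob N \<mu>) (- kac_Omega \<epsilon> N t)
      \<le> measure_pmf.prob (kac_prob N \<mu>) {\<xi>. 3 / 4 * \<epsilon> \<le> \<bar>kac_mean N \<xi> t - p\<bar>}"
  proof (rule measure_pmf.finite_measure_mono_AE)
    show "AE \<xi> in kac_prob N \<mu>. \<xi> \<in> - kac_Omega \<epsilon> N t \<longrightarrow>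
        \<xi> \<in> {\<xi>. 3 / 4 * \<epsilon> \<le> \<bar>kac_mean N \<xi> t - p\<bar>}"
      using AE_kac_markings by eventually_elim (use dev in \<open>simp add: kac_Omega_def\<close>)
  qed simp
  also have "\<dots> \<le> 2 * exp (- real (N div t) * (3 / 4 * \<epsilon>)\<^sup>2 / 2)"
    unfolding p_def using assms \<open>0 < t\<close> \<open>t \<le> N\<close> by (intro kac_mean_concentration) auto
  \<comment> \<open>Here \<open>9 / 32\<close> is \<open>(3 / 4)\<^sup>2 / 2\<close>, and
    \<open>9 / 32 * (2 * M - 1) = 9 / 16 * M - 9 / 32\<close> is at least
    \<open>1 / 2 * M - 1 / 2\<close>.\<close>
  also have "\<dots> \<le> 2 * exp (2 * (\<epsilon> / 2)^2 + - 2 * (\<epsilon> / 2)^2 * M)"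
  proof -
    have "(2 * M - 1) * \<epsilon>\<^sup>2 \<le> real (N div t) * \<epsilon>\<^sup>2" using k by (intro mult_right_mono) auto
    moreover have "0 \<le> M * \<epsilon>\<^sup>2" using M by simp
    moreover have "0 \<le> \<epsilon>\<^sup>2" by simp
    ultimately have "- (9 / 32) * (real (N div t) * \<epsilon>\<^sup>2) \<le> 1 / 2 * \<epsilon>\<^sup>2 - 1 / 2 * (M * \<epsilon>\<^sup>2)"
      unfolding left_diff_distrib mult.assoc by linarith
    then show ?thesis by (simp add: power_mult_distrib power_divide algebra_simps)
  qed
  finally show ?thesis by (simp only: M_def exp_add mult.assoc)
qed

section \<open>Union bound over the times up to \<open>kac_tN\<close>\<close>

theorem theorem6p1:
  fixes \<epsilon> \<alpha> \<mu> :: real and N :: nat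
  assumes "0 < \<epsilon>"
    and "0 < \<alpha>" and "\<alpha> < 1"
    and "0 < \<mu>" and "\<mu> \<le> 1"
    and "real N > kac_N_eps \<epsilon> \<alpha>"
  shows "(\<forall>t::nat. kac_t0 \<epsilon> \<mu> \<le> ereal (real t) \<and> real t \<le> kac_tN \<alpha> N \<and> (\<mu> = 1 / 2 \<longrightarrow> 0 < t) \<longrightarrow>
            measure_pmf.prob (kac_prob N \<mu>) (kac_Omega \<epsilon> N t)
              \<ge> 1 - 2 * exp (2 * (\<epsilon> / 2)^2) * exp (- 2 * (\<epsilon> / 2)^2 * real N powr (1 - \<alpha>)))
       \<and> measure_pmf.prob (kac_prob N \<mu>) (kac_Omega_between \<epsilon> N (kac_t0 \<epsilon> \<mu>) (kac_tN \<alpha> N))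
           \<ge> 1 - exp (2 * (\<epsilon> / 2)^2) * real N powr \<alpha> * exp (- 2 * (\<epsilon> / 2)^2 * real N powr (1 - \<alpha>))
       \<and> (kac_t0 \<epsilon> \<mu> \<le> 1 \<longrightarrow>
           measure_pmf.prob (kac_prob N \<mu>) (kac_Omega_upto \<epsilon> N (kac_tN \<alpha> N))
             \<ge> 1 - exp (2 * (\<epsilon> / 2)^2) * real N powr \<alpha> * exp (- 2 * (\<epsilon> / 2)^2 * real N powr (1 - \<alpha>)))"
    (is "?single \<and> ?between \<and> ?upto")
proof -
  let ?P = "measure_pmf.prob (kac_prob N \<mu>)"
  define q where "q = 2 * exp (2 * (\<epsilon> / 2)^2) * exp (- 2 * (\<epsilon> / 2)^2 * real N powr (1 - \<alpha>))"
  have "0 < N" using assms(6) by (cases N) (auto simp: kac_N_eps_def)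
  have compl: "?P A = 1 - ?P (- A)" for A
    using measure_pmf.prob_compl[of "- A"] by (simp add: Compl_eq_Diff_UNIV[symmetric])
  have tail: "?P (- kac_Omega \<epsilon> N t) \<le> q"
    if "kac_t0 \<epsilon> \<mu> \<le> ereal (real t)" "real t \<le> kac_tN \<alpha> N" "\<mu> = 1 / 2 \<longrightarrow> 0 < t" for t
    unfolding q_def using assms \<open>0 < N\<close> that by (intro prob_compl_kac_Omega_le) auto
  have ?single
    unfolding compl[of "kac_Omega _ _ _"] using tail by (auto simp: q_def)
  moreover have between: ?between
  proof -
    define T where "T = {t::nat. 1 \<le> t \<and> kac_t0 \<epsilon> \<mu> \<le> ereal (real t) \<and> real t \<le> kac_tN \<alpha> N}"
    have T: "T \<subseteq> {1..nat \<lfloor>kac_tN \<alpha> N\<rfloor>}" by (auto simp: T_def le_nat_floor)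
    have "real (card T) \<le> real (nat \<lfloor>kac_tN \<alpha> N\<rfloor>)"
      using card_mono[OF _ T] by simp
    also have "\<dots> \<le> kac_tN \<alpha> N" by (rule of_nat_floor) (simp add: kac_tN_def)
    finally have card: "real (card T) \<le> kac_tN \<alpha> N" .
    \<comment> \<open>The complement on the left contains all non-markings, which the union misses
      if \<open>T\<close> is empty; they form a null set.\<close>
    have "?P (- kac_Omega_between \<epsilon> N (kac_t0 \<epsilon> \<mu>) (kac_tN \<alpha> N))
        \<le> ?P (\<Union>t\<in>T. - kac_Omega \<epsilon> N t)"
      by (rule measure_pmf.finite_measure_mono_AE)
         (use AE_kac_markings in eventually_elim, auto simp: kac_Omega_between_def T_def)
    also have "\<dots> \<le> (\<Sum>t\<in>T. ?P (- kac_Omega \<epsilon> N t))"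
      by (rule measure_pmf.finite_measure_subadditive_finite) (use T finite_subset in auto)
    also have "\<dots> \<le> (\<Sum>t\<in>T. q)"
      by (intro sum_mono tail) (auto simp: T_def)
    \<comment> \<open>The factor \<open>1 / 2\<close> of \<open>kac_tN\<close> cancels the factor
      \<open>2\<close> of \<open>q\<close>, which leaves \<open>N powr \<alpha>\<close>.\<close>
    also have "\<dots> \<le> kac_tN \<alpha> N * q"
      using card by (simp add: q_def mult_right_mono)
    finally show ?thesis
      unfolding compl[of "kac_Omega_between _ _ _ _"] by (simp add: q_def kac_tN_def algebra_simps)
  qed
  moreover have ?upto
  proof
    assume "kac_t0 \<epsilon> \<mu> \<le> 1"
    \<comment> \<open>Every time from \<open>1\<close> on lies past \<open>kac_t0\<close>, so the
      two intersections run over the same times.\<close>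
    then have "kac_t0 \<epsilon> \<mu> \<le> ereal (real t)" if "1 \<le> t" for t
      using that by (elim order_trans) simp
    then have "kac_Omega_upto \<epsilon> N (kac_tN \<alpha> N) = kac_Omega_between \<epsilon> N (kac_t0 \<epsilon> \<mu>) (kac_tN \<alpha> N)"
      unfolding kac_Omega_upto_def kac_Omega_between_def by (metis (lifting))
    with between show "1 - exp (2 * (\<epsilon> / 2)^2) * real N powr \<alpha> * exp (- 2 * (\<epsilon> / 2)^2 * real N powr (1 - \<alpha>))
        \<le> ?P (kac_Omega_upto \<epsilon> N (kac_tN \<alpha> N))" by simp
  qed
  ultimately show ?thesis by blast
qed

end
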